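(* The following conditions on a curve $\gamma\in\mathcal{M}$ are equivalent: (i) $\gamma$ is an Euler elastic curve, i.e. critical for the elastic energy $E_3$ under constrained length $E_1$ and total torsion $E_2$: $G_3=c_1G_1+c_2G_2$ for some $c_1,c_2\in\mathbb{R}$. (ii) $\gamma$ is critical for total torsion with length and area $E_{-1}$ constraints: for some axis of $h$ and some constants, $G_2=c_1G_1+c_{-1}G_{-1}$. (iii) $\gamma$ is critical for length with area $E_{-1}$ and volume $E_{-2}$ constraints: for some axis of $h$ and some constants, $G_1=c_{-1}G_{-1}+c_{-2}G_{-2}$. (iv) The helicity filament flow $\dot\gamma=Y_2$ evolves $\gamma$, modulo the vortex filament flow $Y_1$ and reparametrization, by a pure translation in the direction of the axis of the monodromy of $\gamma$: for some axis of $h$ and constants, $Y_2=c_1Y_1+c_0Y_0+c\,v$. (v) The vortex filament flow $\dot\gamma=Y_1$ evolves $\gamma$, modulo reparametrization, by a Euclidean motion with axis along the monodromy of $\gamma$: for some axis of $h$ and constants, $Y_1=c_0Y_0+b\,v\times(\gamma-p_0)+c\,v$.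
   Context: Let $M\cong\mathbb{R}$ be an oriented 1-manifold with a fixed translation $\tau\in\mathrm{Diff}(M)$, $M/\tau\cong S^1$, and $I\subset M$ a fundamental domain. Let $h(p)=Ap+a$ ($A\in SO(3)$, $a\in\mathbb{R}^3$), and let $\mathcal{M}=\mathcal{M}_h$ be the space of smooth immersions $\gamma\colon M\to\mathbb{R}^3$ with $\gamma\circ\tau=h\circ\gamma$. Let $dx$ be the arclength 1-form of $\gamma$, $(\ )'$ the arclength derivative, $T=\gamma'$. An axis of $h$ is a line $p_0+\mathbb{R}v$ ($|v|=1$) with $Av=v$ that is mapped to itself by $h$; it is unique if $A\ne \mathrm{id}$. Functionals: length $E_1=\int_Idx$; total torsion $E_2=\int_I(\nu',T\times\nu)dx$ mod $2\pi$ ($\nu$ any unit normal field along $\gamma$ with $\nu\circ\tau=A\nu$); elastic energy $E_3=\frac12\int_I|\gamma''|^2dx$; and, for an axis $p_0+\mathbb{R}v$ and $q=\gamma-p_0$, area $E_{-1}=\frac12\int_I(q\times dq,v)$ and volume $E_{-2}=-\frac12\int_I|q-(q,v)v|^2(dq,v)$. Their variational gradients with respect to the $L^2$-metric $\langle\xi,\eta\rangle=\int_I(\xi,\eta)dx$ are $G_1=-\gamma''$, $G_2=-\gamma'\times\gamma'''$, $G_3=(\gamma'''+\frac32|\gamma''|^2\gamma')'$, $G_{-1}=\gamma'\times v$, $G_{-2}=\gamma'\times(v\times(\gamma-p_0))$. Here "$\gamma$ is critical for $E$ under constraints $E_{i_1},\dots,E_{i_m}$" means that the constrained Euler–Lagrange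 equation $G_E=\sum_j c_{i_j}G_{i_j}$ holds for some real constants (Lagrange multipliers). The flows are $Y_0=\gamma'$ (reparametrization), $Y_1=\gamma'\times\gamma''$ (vortex filament flow), $Y_2=-\gamma'''-\frac32|\gamma''|^2\gamma'$ (helicity filament flow). *)

theory Defs
  imports "HOL-Analysis.Analysis"
begin

section \<open>Curves with monodromy\<close>

definition vderiv :: "(real \<Rightarrow> 'a::real_normed_vector) \<Rightarrow> real \<Rightarrow> 'a" where
  "vderiv f = (\<lambda>t. vector_derivative f (at t))"

definition smooth :: "(real \<Rightarrow> 'a::real_normed_vector) \<Rightarrow> bool" where
  "smooth f \<longleftrightarrow> (\<forall>k t. (vderiv ^^ k) f differentiable (at t))"

definition diffeo :: "(real \<Rightarrow> real) \<Rightarrow> bool" where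
  "diffeo \<phi> \<longleftrightarrow> bij \<phi> \<and> smooth \<phi> \<and> smooth (inv \<phi>)"

text \<open>The oriented 1-manifold is the real line with its standard orientation, but \<open>\<tau>\<close> need only be
  the translation by 1 in some global coordinate \<open>\<phi>\<close>; then \<open>t \<mapsto> exp (2 \<pi> \<i> \<phi> t)\<close> identifies
  the quotient by \<open>\<tau>\<close> with the circle.\<close>

definition translation :: "(real \<Rightarrow> real) \<Rightarrow> bool" where
  "translation \<tau> \<longleftrightarrow> diffeo \<tau> \<and> (\<exists>\<phi>. diffeo \<phi> \<and> (\<forall>t. \<phi> (\<tau> t) = \<phi> t + 1))"

definition motion :: "real^3^3 \<Rightarrow> real^3 \<Rightarrow> real^3 \<Rightarrow> real^3" where
  "motion A a p = A *v p + a"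

definition monodromy_curves ::
    "(real \<Rightarrow> real) \<Rightarrow> real^3^3 \<Rightarrow> real^3 \<Rightarrow> (real \<Rightarrow> real^3) set" where
  "monodromy_curves \<tau> A a =
     {\<gamma>. smooth \<gamma> \<and> (\<forall>t. vderiv \<gamma> t \<noteq> 0) \<and> \<gamma> \<circ> \<tau> = motion A a \<circ> \<gamma>}"

text \<open>The line through \<open>p0\<close> in direction \<open>v\<close> is an axis of \<open>motion A a\<close>; it need not be fixed
  pointwise.\<close>

definition is_axis :: "real^3^3 \<Rightarrow> real^3 \<Rightarrow> real^3 \<Rightarrow> real^3 \<Rightarrow> bool" where
  "is_axis A a p0 v \<longleftrightarrow> norm v = 1 \<and> A *v v = v \<and>
     motion A a ` range (\<lambda>s. p0 + s *\<^sub>R v) = range (\<lambda>s. p0 + s *\<^sub>R v)"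

section \<open>Arclength derivatives, variational gradients and flows\<close>

text \<open>\<open>arc_deriv \<gamma> f\<close> is the derivative of \<open>f\<close> with respect to the arclength of \<open>\<gamma>\<close>, and
  \<open>arc \<gamma> k\<close> is the \<open>k\<close>-th arclength derivative of \<open>\<gamma>\<close> itself.\<close>

definition arc_deriv :: "(real \<Rightarrow> real^3) \<Rightarrow> (real \<Rightarrow> real^3) \<Rightarrow> real \<Rightarrow> real^3" where
  "arc_deriv \<gamma> f = (\<lambda>t. (1 / norm (vderiv \<gamma> t)) *\<^sub>R vderiv f t)"

definition arc :: "(real \<Rightarrow> real^3) \<Rightarrow> nat \<Rightarrow> real \<Rightarrow> real^3" where
  "arc \<gamma> k = (arc_deriv \<gamma> ^^ k) \<gamma>"

text \<open>The \<open>L\<^sup>2\<close>-gradients of length, total torsion, elastic energy, and (for an axis) area and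
  volume.\<close>

definition grad_length :: "(real \<Rightarrow> real^3) \<Rightarrow> real \<Rightarrow> real^3" where
  "grad_length \<gamma> = (\<lambda>t. - arc \<gamma> 2 t)"

definition grad_torsion :: "(real \<Rightarrow> real^3) \<Rightarrow> real \<Rightarrow> real^3" where
  "grad_torsion \<gamma> = (\<lambda>t. - cross3 (arc \<gamma> 1 t) (arc \<gamma> 3 t))"

definition grad_elastic :: "(real \<Rightarrow> real^3) \<Rightarrow> real \<Rightarrow> real^3" where
  "grad_elastic \<gamma> =
     arc_deriv \<gamma> (\<lambda>t. arc \<gamma> 3 t + (3 / 2 * (norm (arc \<gamma> 2 t))\<^sup>2) *\<^sub>R arc \<gamma> 1 t)"

definition grad_area :: "real^3 \<Rightarrow> (real \<Rightarrow> real^3) \<Rightarrow> real \<Rightarrow> real^3" where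
  "grad_area v \<gamma> = (\<lambda>t. cross3 (arc \<gamma> 1 t) v)"

definition grad_volume :: "real^3 \<Rightarrow> real^3 \<Rightarrow> (real \<Rightarrow> real^3) \<Rightarrow> real \<Rightarrow> real^3" where
  "grad_volume p0 v \<gamma> = (\<lambda>t. cross3 (arc \<gamma> 1 t) (cross3 v (\<gamma> t - p0)))"

text \<open>Constrained criticality is the Euler--Lagrange equation with Lagrange multipliers \<open>c\<close>, for
  an energy with gradient \<open>G\<close> and constraints with gradients \<open>Gs\<close>.\<close>

definition critical :: "(real \<Rightarrow> real^3) \<Rightarrow> (real \<Rightarrow> real^3) list \<Rightarrow> bool" where
  "critical G Gs \<longleftrightarrow>
     (\<exists>c :: nat \<Rightarrow> real. \<forall>t. G t = (\<Sum>j<length Gs. c j *\<^sub>R (Gs ! j) t))"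

definition reparam_flow :: "(real \<Rightarrow> real^3) \<Rightarrow> real \<Rightarrow> real^3" where
  "reparam_flow \<gamma> = arc \<gamma> 1"

definition vortex_flow :: "(real \<Rightarrow> real^3) \<Rightarrow> real \<Rightarrow> real^3" where
  "vortex_flow \<gamma> = (\<lambda>t. cross3 (arc \<gamma> 1 t) (arc \<gamma> 2 t))"

definition helicity_flow :: "(real \<Rightarrow> real^3) \<Rightarrow> real \<Rightarrow> real^3" where
  "helicity_flow \<gamma> =
     (\<lambda>t. - arc \<gamma> 3 t - (3 / 2 * (norm (arc \<gamma> 2 t))\<^sup>2) *\<^sub>R arc \<gamma> 1 t)"

end

theory Submission
  imports Defs
begin

text \<open>Write \<open>T\<close> for the unit tangent and primes for arclength derivatives. Every condition is a form
  of one system of conservation laws. Condition (i) says that the arclength derivative of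
  \<open>T'' + 3/2 |T'|\<^sup>2 T + c\<^sub>1 T + c\<^sub>2 T \<times> T'\<close> vanishes, so this vector is a constant \<open>w\<close>
  (\<open>elastic_first_integral\<close>). Taking its cross product with \<open>T\<close> produces another total derivative,
  so \<open>T \<times> T' - c\<^sub>2 T + w \<times> \<gamma>\<close> is a constant \<open>u\<close> as well (\<open>elastic_second_integral\<close>); up to
  the choice of axis this is condition (v). From there one returns without losing information:
  differentiating (v) gives (ii), and taking the cross product of (v) with \<open>T\<close> gives (iii). In both
  equations the component along \<open>T\<close> has been lost, but up to known terms that component is constant,
  because its derivative vanishes. This recovers (iv) from (ii) and (v) from (iii). Finally,
  differentiating (iv) gives (i). The steps from (v) to (ii) and on to (iv), and those
  between (v) and (iii), keep the axis.

  The monodromy enters only where (i) has to produce an axis (\<open>elastic_imp_vortex_motion\<close>).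
  An arclength derivative at \<open>\<tau> t\<close> is the \<open>A\<close>-image of the one at \<open>t\<close>, because \<open>\<tau>\<close> preserves
  orientation. If an expression in \<open>T\<close>, \<open>T'\<close>, \<open>T''\<close> with that equivariance equals
  \<open>w \<times> \<gamma> + u\<close> for some \<open>w \<noteq> 0\<close> with \<open>A w = w\<close>, then \<open>x \<mapsto> w \<times> x + u\<close> is the velocity field
  of a screw motion, and its screw axis is an axis of the monodromy
  (\<open>equivariant_rotation_field_axis\<close>). This construction is uniform in \<open>A\<close>; in particular it shows
  for \<open>A = id\<close> that the direction found is parallel to the translation part \<open>a\<close>. If the constant \<open>w\<close>
  vanishes, \<open>\<gamma>\<close> is a helix, a circle or a straight line, and the same construction applies to a
  simpler equation of that form.\<close>

section \<open>Smooth functions of a real variable\<close>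

text \<open>Smooth functions are closed under products and reciprocal norms by induction on the order: the
  derivative contains the original functions again, now with one order of differentiability to
  spare.\<close>

definition diffable :: "nat \<Rightarrow> (real \<Rightarrow> 'a::real_normed_vector) \<Rightarrow> bool" where
  "diffable n f \<longleftrightarrow> (\<forall>k<n. \<forall>t. (vderiv ^^ k) f differentiable (at t))"

lemma smooth_iff_diffable: "smooth f \<longleftrightarrow> (\<forall>n. diffable n f)"
  by (auto simp: smooth_def diffable_def)

lemma diffable_0 [simp]: "diffable 0 f"
  by (simp add: diffable_def)

lemma diffable_Suc:
  "diffable (Suc n) f \<longleftrightarrow> (\<forall>t. f differentiable (at t)) \<and> diffable n (vderiv f)"
  by (auto simp: diffable_def All_less_Suc2 funpow_swap1)

lemma diffable_SucD: "diffable (Suc n) f \<Longrightarrow> diffable n f"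
  by (auto simp: diffable_def)

text \<open>The form in which a differentiation rule enters an induction on the order.\<close>

lemma diffable_SucI:
  assumes "\<And>t. (f has_vector_derivative f' t) (at t)" "diffable n f'"
  shows "diffable (Suc n) f"
proof -
  have "vderiv f = f'"
    using assms(1) by (auto simp: vderiv_def fun_eq_iff intro: vector_derivative_at)
  then show ?thesis
    using assms by (auto simp: diffable_Suc intro: differentiableI_vector)
qed

lemma has_vector_derivative_vderiv:
  "f differentiable (at t) \<Longrightarrow> (f has_vector_derivative vderiv f t) (at t)"
  by (simp add: vderiv_def vector_derivative_works)

lemma diffable_const [simp]: "diffable n (\<lambda>t. c)"
  by (induction n arbitrary: c) (auto intro!: diffable_SucI derivative_eq_intros)

lemma diffable_add:
  "diffable n f \<Longrightarrow> diffable n g \<Longrightarrow> diffable n (\<lambda>t. f t + g t)"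
proof (induction n arbitrary: f g)
  case (Suc n)
  then show ?case
    by (intro diffable_SucI [where f' = "\<lambda>t. vderiv f t + vderiv g t"])
       (auto simp: diffable_Suc intro!: has_vector_derivative_add has_vector_derivative_vderiv)
qed simp

lemma diffable_bilinear:
  assumes "bounded_bilinear h"
  shows "diffable n f \<Longrightarrow> diffable n g \<Longrightarrow> diffable n (\<lambda>t. h (f t) (g t))"
proof (induction n arbitrary: f g)
  case (Suc n)
  have "diffable n (\<lambda>t. h (f t) (vderiv g t) + h (vderiv f t) (g t))"
    using Suc.prems [THEN diffable_SucD] Suc.prems [unfolded diffable_Suc]
    by (intro diffable_add Suc.IH) auto
  moreover have "((\<lambda>t. h (f t) (g t)) has_vector_derivative
      h (f t) (vderiv g t) + h (vderiv f t) (g t)) (at t)" for t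
    using Suc.prems
    by (intro bounded_bilinear.has_vector_derivative [OF assms] has_vector_derivative_vderiv)
       (auto simp: diffable_Suc)
  ultimately show ?case
    by (intro diffable_SucI)
qed simp

lemma diffable_inverse_norm:
  fixes g :: "real \<Rightarrow> 'a::real_inner"
  assumes nz: "\<And>t. g t \<noteq> 0"
  shows "diffable n g \<Longrightarrow> diffable n (\<lambda>t. 1 / norm (g t))"
proof (induction n)
  case (Suc n)
  \<comment> \<open>For \<open>\<sigma> = 1 / |g|\<close> the derivative \<open>- \<sigma>\<^sup>3 (g \<bullet> g')\<close> is again a product of functions whose
    \<open>n\<close>-fold differentiability is known, \<open>\<sigma>\<close> itself included.\<close>
  define \<sigma> where "\<sigma> t = 1 / norm (g t)" for t
  have "(\<sigma> has_vector_derivative (-1) * ((\<sigma> t * \<sigma> t) * (\<sigma> t * (g t \<bullet> vderiv g t)))) (at t)" for t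
  proof -
    have g: "(g has_vector_derivative vderiv g t) (at t)"
      using Suc.prems by (intro has_vector_derivative_vderiv) (simp add: diffable_Suc)
    have "((\<lambda>t. g t \<bullet> g t) has_vector_derivative (g t \<bullet> vderiv g t + vderiv g t \<bullet> g t)) (at t)"
      by (rule bounded_bilinear.has_vector_derivative [OF bounded_bilinear_inner g g])
    then have "((\<lambda>t. g t \<bullet> g t) has_real_derivative 2 * (g t \<bullet> vderiv g t)) (at t)"
      by (simp add: has_real_derivative_iff_has_vector_derivative inner_commute)
    moreover have pos: "g t \<bullet> g t > 0"
      using nz by simp
    then have "sqrt (g t \<bullet> g t) \<noteq> 0" by simp
    ultimately have "((\<lambda>t. inverse (sqrt (g t \<bullet> g t))) has_real_derivative
        - (inverse (sqrt (g t \<bullet> g t)) * (2 * (g t \<bullet> vderiv g t) * (inverse (sqrt (g t \<bullet> g t)) / 2))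
            * inverse (sqrt (g t \<bullet> g t)))) (at t)"
      using pos by (auto intro!: DERIV_inverse' DERIV_chain' [OF _ DERIV_real_sqrt, THEN DERIV_cong])
    moreover have "(\<lambda>t. inverse (sqrt (g t \<bullet> g t))) = \<sigma>"
      by (simp add: \<sigma>_def fun_eq_iff norm_eq_sqrt_inner field_simps)
    ultimately show ?thesis
      by (simp add: has_real_derivative_iff_has_vector_derivative \<sigma>_def norm_eq_sqrt_inner field_simps)
  qed
  moreover have "diffable n (\<lambda>t. (-1) * ((\<sigma> t * \<sigma> t) * (\<sigma> t * (g t \<bullet> vderiv g t))))"
  proof -
    have "diffable n \<sigma>" "diffable n g" "diffable n (vderiv g)"
      using Suc.IH Suc.prems [THEN diffable_SucD] Suc.prems [unfolded diffable_Suc]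
      by (auto simp: \<sigma>_def [abs_def])
    then show ?thesis
      by (intro diffable_bilinear [OF bounded_bilinear_mult]
          diffable_bilinear [OF bounded_bilinear_inner]) auto
  qed
  ultimately show ?case
    unfolding \<sigma>_def by (rule diffable_SucI)
qed simp

lemma smooth_arc_deriv:
  assumes "smooth \<gamma>" "\<And>t. vderiv \<gamma> t \<noteq> 0" "smooth f"
  shows "smooth (arc_deriv \<gamma> f)"
proof -
  have "smooth (vderiv \<gamma>)" "smooth (vderiv f)"
    using assms(1,3) unfolding smooth_iff_diffable by (meson diffable_Suc)+
  then show ?thesis
    unfolding arc_deriv_def smooth_iff_diffable
    by (auto intro!: diffable_bilinear [OF bounded_bilinear_scaleR] diffable_inverse_norm assms(2))
qed

lemma smooth_arc:
  assumes "smooth \<gamma>" "\<And>t. vderiv \<gamma> t \<noteq> 0"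
  shows "smooth (arc \<gamma> k)"
  unfolding arc_def by (induction k) (simp_all add: assms smooth_arc_deriv)

lemma smooth_differentiable: "smooth f \<Longrightarrow> f differentiable (at t)"
  using diffable_Suc smooth_iff_diffable by blast

lemma smooth_continuous: "smooth f \<Longrightarrow> continuous_on UNIV f"
  by (simp add: continuous_at_imp_continuous_on differentiable_imp_continuous_within smooth_differentiable)

text \<open>Orientation: in the coordinate \<open>\<phi>\<close>, which is monotone, \<open>\<tau>\<close> is the increasing map
  \<open>x \<mapsto> x + 1\<close>, so \<open>\<tau>\<close> is increasing even when \<open>\<phi>\<close> reverses the orientation.\<close>

lemma translation_deriv_nonneg:
  assumes "translation \<tau>"
  shows "\<tau> differentiable (at t)" and "vderiv \<tau> t \<ge> 0"
proof -
  obtain \<phi> where \<phi>: "diffeo \<phi>" "\<And>t. \<phi> (\<tau> t) = \<phi> t + 1" and \<tau>: "smooth \<tau>"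
    using assms by (auto simp: translation_def diffeo_def)
  then show diff: "\<tau> differentiable (at t)"
    by (simp add: smooth_differentiable)
  have "continuous_on UNIV \<phi>" "inj \<phi>"
    using \<phi>(1) by (auto simp: diffeo_def smooth_continuous bij_def)
  then have "strict_mono \<phi> \<or> strict_antimono_on UNIV \<phi>"
    using injective_eq_monotone_map [of UNIV \<phi>] by auto
  then have "mono \<tau>"
  proof
    assume "strict_mono \<phi>"
    then show ?thesis
      using \<phi>(2) by (intro monoI) (metis add_le_cancel_right strict_mono_less_eq)
  next
    assume anti: "strict_antimono_on UNIV \<phi>"
    have "\<tau> x \<le> \<tau> y" if "x \<le> y" for x y
    proof (rule ccontr)
      assume "\<not> \<tau> x \<le> \<tau> y"
      then have "\<phi> (\<tau> x) < \<phi> (\<tau> y)"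
        using monotone_onD [OF anti, of "\<tau> y" "\<tau> x"] by auto
      then have "\<phi> x < \<phi> y"
        by (simp add: \<phi>(2))
      then show False
        using monotone_onD [OF anti, of x y] that by (cases "x = y") auto
    qed
    then show ?thesis
      by (rule monoI)
  qed
  then show "vderiv \<tau> t \<ge> 0"
    using has_vector_derivative_vderiv [OF diff]
    by (intro mono_on_imp_deriv_nonneg [of UNIV \<tau>])
       (auto simp: has_real_derivative_iff_has_vector_derivative)
qed


section \<open>Arclength calculus\<close>

unbundle cross3_syntax

text \<open>As a relation, differentiation by arclength has compositional rules. The derivative is polymorphic
  so that the inner products of vector fields along the curve are covered too.\<close>

definition has_arc_deriv ::
    "(real \<Rightarrow> real^3) \<Rightarrow> (real \<Rightarrow> 'a::real_normed_vector) \<Rightarrow> (real \<Rightarrow> 'a) \<Rightarrow> bool" where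
  "has_arc_deriv \<gamma> f f' \<longleftrightarrow>
     (\<forall>t. (f has_vector_derivative norm (vderiv \<gamma> t) *\<^sub>R f' t) (at t))"

lemma has_arc_deriv_const: "has_arc_deriv \<gamma> (\<lambda>t. c) (\<lambda>t. 0)"
  by (simp add: has_arc_deriv_def)

lemma has_arc_deriv_add:
  "has_arc_deriv \<gamma> f f' \<Longrightarrow> has_arc_deriv \<gamma> g g' \<Longrightarrow>
     has_arc_deriv \<gamma> (\<lambda>t. f t + g t) (\<lambda>t. f' t + g' t)"
  by (simp add: has_arc_deriv_def scaleR_add_right has_vector_derivative_add)

lemma has_arc_deriv_diff:
  "has_arc_deriv \<gamma> f f' \<Longrightarrow> has_arc_deriv \<gamma> g g' \<Longrightarrow>
     has_arc_deriv \<gamma> (\<lambda>t. f t - g t) (\<lambda>t. f' t - g' t)"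
  by (simp add: has_arc_deriv_def scaleR_diff_right has_vector_derivative_diff)

lemma has_arc_deriv_bilinear:
  assumes "bounded_bilinear h" "has_arc_deriv \<gamma> f f'" "has_arc_deriv \<gamma> g g'"
  shows "has_arc_deriv \<gamma> (\<lambda>t. h (f t) (g t)) (\<lambda>t. h (f t) (g' t) + h (f' t) (g t))"
proof -
  interpret h: bounded_bilinear h
    by fact
  show ?thesis
    using h.has_vector_derivative assms(2,3)
    by (fastforce simp: has_arc_deriv_def scaleR_add_right h.scaleR_right h.scaleR_left)
qed

lemmas has_arc_deriv_inner = has_arc_deriv_bilinear [OF bounded_bilinear_inner]
lemmas has_arc_deriv_scaleR = has_arc_deriv_bilinear [OF bounded_bilinear_scaleR]
lemmas has_arc_deriv_cross =
  has_arc_deriv_bilinear [OF bilinear_cross [unfolded bilinear_conv_bounded_bilinear]]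

lemma has_arc_deriv_const_scaleR:
  "has_arc_deriv \<gamma> f f' \<Longrightarrow> has_arc_deriv \<gamma> (\<lambda>t. c *\<^sub>R f t) (\<lambda>t. c *\<^sub>R f' t)"
  using has_arc_deriv_scaleR [OF has_arc_deriv_const] by force

lemma has_arc_deriv_const_cross:
  "has_arc_deriv \<gamma> f f' \<Longrightarrow> has_arc_deriv \<gamma> (\<lambda>t. c \<times> f t) (\<lambda>t. c \<times> f' t)"
  using has_arc_deriv_cross [OF has_arc_deriv_const] by force

lemmas has_arc_deriv_intros =
  has_arc_deriv_const has_arc_deriv_add has_arc_deriv_diff has_arc_deriv_const_scaleR
  has_arc_deriv_const_cross has_arc_deriv_inner has_arc_deriv_scaleR has_arc_deriv_cross

lemma has_arc_deriv_cong:
  "has_arc_deriv \<gamma> f f' \<Longrightarrow> (\<And>t. f' t = f'' t) \<Longrightarrow> has_arc_deriv \<gamma> f f''"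
  by (simp add: has_arc_deriv_def)

lemma has_arc_deriv_zero_const:
  assumes "has_arc_deriv \<gamma> f (\<lambda>t. 0)"
  obtains c where "\<And>t. f t = c"
  using has_vector_derivative_zero_constant [of UNIV f] assms
  by (auto simp: has_arc_deriv_def)

lemma critical_pair:
  "critical G [G1, G2] \<longleftrightarrow> (\<exists>c d. \<forall>t. G t = c *\<^sub>R G1 t + d *\<^sub>R G2 t)"
proof
  assume "critical G [G1, G2]"
  then show "\<exists>c d. \<forall>t. G t = c *\<^sub>R G1 t + d *\<^sub>R G2 t"
    by (auto simp: critical_def numeral_2_eq_2)
next
  assume "\<exists>c d. \<forall>t. G t = c *\<^sub>R G1 t + d *\<^sub>R G2 t"
  then obtain c d where "\<forall>t. G t = c *\<^sub>R G1 t + d *\<^sub>R G2 t"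
    by blast
  then show "critical G [G1, G2]"
    unfolding critical_def
    by (intro exI [of _ "\<lambda>j. if j = 0 then c else d"]) (simp add: numeral_2_eq_2)
qed

section \<open>The frame of a regular curve\<close>

locale regular_curve =
  fixes \<gamma> :: "real \<Rightarrow> real^3"
  assumes smooth: "smooth \<gamma>" and immersed: "\<And>t. vderiv \<gamma> t \<noteq> 0"
begin

definition "T = arc \<gamma> 1"
definition "T' = arc \<gamma> 2"
definition "T'' = arc \<gamma> 3"

lemma gradients_eq:
  "grad_length \<gamma> t = - T' t"
  "grad_torsion \<gamma> t = - (T t \<times> T'' t)"
  "grad_area v \<gamma> t = T t \<times> v"
  "grad_volume p0 v \<gamma> t = T t \<times> (v \<times> (\<gamma> t - p0))"
  by (simp_all add: grad_length_def grad_torsion_def grad_area_def grad_volume_def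
      T_def T'_def T''_def)

lemma flows_eq:
  "reparam_flow \<gamma> t = T t"
  "vortex_flow \<gamma> t = T t \<times> T' t"
  "helicity_flow \<gamma> t = - T'' t - (3 / 2 * (T' t \<bullet> T' t)) *\<^sub>R T t"
  by (simp_all add: reparam_flow_def vortex_flow_def helicity_flow_def T_def T'_def T''_def
      dot_square_norm)

abbreviation arcD :: "(real \<Rightarrow> 'a::real_normed_vector) \<Rightarrow> (real \<Rightarrow> 'a) \<Rightarrow> bool" where
  "arcD \<equiv> has_arc_deriv \<gamma>"

lemma has_arc_deriv_arc_deriv:
  "(\<And>t. f differentiable (at t)) \<Longrightarrow> arcD f (arc_deriv \<gamma> f)"
  using immersed has_vector_derivative_vderiv
  by (fastforce simp: has_arc_deriv_def arc_deriv_def)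

lemma has_arc_deriv_unique:
  assumes "arcD f f'" "arcD f g'"
  shows "f' t = g' t"
  using vector_derivative_unique_at [of f _ t] assms immersed
  by (fastforce simp: has_arc_deriv_def)

lemma arc_Suc: "arc \<gamma> (Suc k) = arc_deriv \<gamma> (arc \<gamma> k)"
  by (simp add: arc_def)

lemma has_arc_deriv_arc: "arcD (arc \<gamma> k) (arc \<gamma> (Suc k))"
  by (simp add: arc_Suc has_arc_deriv_arc_deriv smooth smooth_arc smooth_differentiable immersed)

lemma has_arc_deriv_curve: "arcD \<gamma> T" "arcD T T'" "arcD T' T''" "arcD T'' (arc \<gamma> 4)"
  using has_arc_deriv_arc [of 0] has_arc_deriv_arc [of 1] has_arc_deriv_arc [of 2]
    has_arc_deriv_arc [of 3]
  by (simp_all add: T_def T'_def T''_def arc_def eval_nat_numeral)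

lemmas curve_intros = has_arc_deriv_intros has_arc_deriv_curve

lemma T_T: "T t \<bullet> T t = 1"
  using immersed by (simp add: T_def arc_def arc_deriv_def dot_square_norm power2_eq_square)

lemma T_T': "T t \<bullet> T' t = 0"
proof -
  have "arcD (\<lambda>t. T t \<bullet> T t) (\<lambda>t. T t \<bullet> T' t + T' t \<bullet> T t)"
    by (intro curve_intros)
  moreover have "arcD (\<lambda>t. T t \<bullet> T t) (\<lambda>t. 0)"
    by (simp add: T_T has_arc_deriv_const)
  ultimately have "T t \<bullet> T' t + T' t \<bullet> T t = 0"
    by (rule has_arc_deriv_unique)
  then show ?thesis
    by (simp add: inner_commute)
qed

lemma T_T'': "T t \<bullet> T'' t = - (T' t \<bullet> T' t)"
proof -
  have "arcD (\<lambda>t. T t \<bullet> T' t) (\<lambda>t. T t \<bullet> T'' t + T' t \<bullet> T' t)"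
    by (intro curve_intros)
  moreover have "arcD (\<lambda>t. T t \<bullet> T' t) (\<lambda>t. 0)"
    by (simp add: T_T' has_arc_deriv_const)
  ultimately have "T t \<bullet> T'' t + T' t \<bullet> T' t = 0"
    by (rule has_arc_deriv_unique)
  then show ?thesis
    by simp
qed

lemma T_cross_cross_T: "T t \<times> (T t \<times> x) = (T t \<bullet> x) *\<^sub>R T t - x"
  by (simp add: Lagrange T_T)

lemma T_cross_cross_T': "T t \<times> (T t \<times> T' t) = - T' t"
  by (simp add: T_cross_cross_T T_T')

lemma has_arc_deriv_vortex: "arcD (\<lambda>t. T t \<times> T' t) (\<lambda>t. T t \<times> T'' t)"
  by (rule has_arc_deriv_cong, (rule curve_intros)+) simp

text \<open>The elastic gradient is defined as a derivative; what has to be shown is that this derivative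
  exists. That makes the gradient integrable.\<close>

lemma has_arc_deriv_helicity: "arcD (\<lambda>t. - helicity_flow \<gamma> t) (grad_elastic \<gamma>)"
proof -
  define E where "E = (\<lambda>t. T'' t + (3 / 2) *\<^sub>R ((T' t \<bullet> T' t) *\<^sub>R T t))"
  have E: "(\<lambda>t. - helicity_flow \<gamma> t) = E" "grad_elastic \<gamma> = arc_deriv \<gamma> E"
    by (auto simp: flows_eq grad_elastic_def E_def dot_square_norm T_def T'_def T''_def)
  have "arcD E (\<lambda>t. arc \<gamma> 4 t +
      (3 / 2) *\<^sub>R ((T' t \<bullet> T' t) *\<^sub>R T' t + (T' t \<bullet> T'' t + T'' t \<bullet> T' t) *\<^sub>R T t))"
    unfolding E_def by (intro curve_intros)
  then have "E differentiable (at t)" for t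
    by (auto simp: has_arc_deriv_def intro: differentiableI_vector)
  then show ?thesis
    unfolding E by (rule has_arc_deriv_arc_deriv)
qed

section \<open>The criticality equations and their integrals\<close>

text \<open>All three gradients are total derivatives, \<open>- T\<close> and \<open>- T \<times> T'\<close> being the primitives on the
  right-hand side. This is the conservation law that belongs to the translations of space.\<close>

lemma elastic_first_integral:
  assumes "\<And>t. grad_elastic \<gamma> t = c1 *\<^sub>R grad_length \<gamma> t + c2 *\<^sub>R grad_torsion \<gamma> t"
  obtains w where
    "\<And>t. - helicity_flow \<gamma> t + c1 *\<^sub>R T t + c2 *\<^sub>R (T t \<times> T' t) = w"
proof -
  have "arcD (\<lambda>t. - helicity_flow \<gamma> t + c1 *\<^sub>R T t + c2 *\<^sub>R (T t \<times> T' t)) (\<lambda>t. 0)"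
    by (rule has_arc_deriv_cong, (rule has_arc_deriv_helicity curve_intros)+)
       (simp add: assms gradients_eq)
  then show ?thesis
    using has_arc_deriv_zero_const that by blast
qed

text \<open>The second conservation law, belonging to the rotations of space. Since \<open>T \<times> (T \<times> T') = - T'\<close>,
  the cross product of \<open>T\<close> with the first integral consists of total derivatives only.\<close>

lemma elastic_second_integral:
  assumes "\<And>t. - helicity_flow \<gamma> t + c1 *\<^sub>R T t + c2 *\<^sub>R (T t \<times> T' t) = w"
  obtains u where "\<And>t. T t \<times> T' t - c2 *\<^sub>R T t = u - w \<times> \<gamma> t"
proof -
  have deriv_0: "T t \<times> T'' t - c2 *\<^sub>R T' t + w \<times> T t = 0" for t
  proof -
    have "T t \<times> w = T t \<times> (T'' t + c2 *\<^sub>R (T t \<times> T' t))"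
      by (simp add: assms [of t, symmetric] flows_eq cross_add_right cross_mult_right
          Cross3.right_diff_distrib)
    then show ?thesis
      by (simp add: cross_add_right cross_mult_right T_cross_cross_T' cross_skew [of w])
  qed
  have "arcD (\<lambda>t. T t \<times> T' t - c2 *\<^sub>R T t + w \<times> \<gamma> t) (\<lambda>t. 0)"
    by (rule has_arc_deriv_cong, (rule curve_intros)+) (simp add: deriv_0)
  then obtain u where "\<And>t. T t \<times> T' t - c2 *\<^sub>R T t + w \<times> \<gamma> t = u"
    using has_arc_deriv_zero_const by blast
  then show ?thesis
    by (intro that [of u]) (simp add: algebra_simps)
qed

text \<open>The cross product of \<open>T\<close> with the equation determines \<open>T''\<close> up to a multiple of \<open>T\<close>, and that
  multiple is fixed by \<open>T \<bullet> T'' = - |T'|\<^sup>2\<close>. The inner product with \<open>T'\<close> shows that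
  \<open>|T'|\<^sup>2 / 2 + c2 (T \<bullet> v)\<close> is constant. This turns the coefficient of \<open>T\<close> into
  \<open>- 3/2 |T'|\<^sup>2\<close> plus a constant, which is the form it has in the helicity flow.\<close>

lemma torsion_critical_imp_helicity:
  assumes "\<And>t. grad_torsion \<gamma> t = c1 *\<^sub>R grad_length \<gamma> t + c2 *\<^sub>R grad_area v \<gamma> t"
  obtains c0 where
    "\<And>t. helicity_flow \<gamma> t = c1 *\<^sub>R vortex_flow \<gamma> t + c0 *\<^sub>R reparam_flow \<gamma> t + c2 *\<^sub>R v"
proof -
  have T'': "T'' t = (c2 * (T t \<bullet> v) - T' t \<bullet> T' t) *\<^sub>R T t - c1 *\<^sub>R (T t \<times> T' t) - c2 *\<^sub>R v" for t
  proof -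
    have "T t \<times> (T t \<times> T'' t) = T t \<times> (c1 *\<^sub>R T' t - c2 *\<^sub>R (T t \<times> v))"
      using assms [of t] by (simp add: gradients_eq algebra_simps)
    then show ?thesis
      by (simp add: T_cross_cross_T T_T'' Cross3.right_diff_distrib cross_mult_right algebra_simps)
  qed
  have deriv_0: "T' t \<bullet> T'' t + c2 * (T' t \<bullet> v) = 0" for t
    by (simp add: T'' inner_diff_right inner_commute [of "T' t" "T t"] T_T' dot_cross_self)
  have "arcD (\<lambda>t. (1/2) *\<^sub>R (T' t \<bullet> T' t) + c2 *\<^sub>R (T t \<bullet> v)) (\<lambda>t. 0)"
    by (rule has_arc_deriv_cong, (rule curve_intros)+)
       (simp add: inner_commute [of "T'' _"] deriv_0)
  then obtain m where m: "\<And>t. (1/2) *\<^sub>R (T' t \<bullet> T' t) + c2 *\<^sub>R (T t \<bullet> v) = m"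
    using has_arc_deriv_zero_const by blast
  show ?thesis
  proof (rule that [of "- m"])
    fix t
    have "c2 * (T t \<bullet> v) - T' t \<bullet> T' t = m - 3/2 * (T' t \<bullet> T' t)"
      using m [of t] by simp
    then show "helicity_flow \<gamma> t = c1 *\<^sub>R vortex_flow \<gamma> t + (- m) *\<^sub>R reparam_flow \<gamma> t + c2 *\<^sub>R v"
      by (simp add: flows_eq T'' scaleR_diff_left)
  qed
qed

text \<open>Differentiation removes the translation \<open>c v\<close>; the remaining terms become gradients.\<close>

lemma helicity_imp_elastic_critical:
  assumes "\<And>t. helicity_flow \<gamma> t = c1 *\<^sub>R vortex_flow \<gamma> t + c0 *\<^sub>R reparam_flow \<gamma> t + c *\<^sub>R v"
  shows "grad_elastic \<gamma> t = c0 *\<^sub>R grad_length \<gamma> t + c1 *\<^sub>R grad_torsion \<gamma> t"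
proof -
  have eq: "(\<lambda>t. - helicity_flow \<gamma> t) =
      (\<lambda>t. (- c1) *\<^sub>R (T t \<times> T' t) + (- c0) *\<^sub>R T t + (- c) *\<^sub>R v)"
    by (simp add: assms flows_eq(1,2) fun_eq_iff)
  have "arcD (\<lambda>t. - helicity_flow \<gamma> t)
     (\<lambda>t. (- c1) *\<^sub>R (T t \<times> T'' t) + (- c0) *\<^sub>R T' t + (- c) *\<^sub>R 0)"
    unfolding eq by (intro has_arc_deriv_vortex curve_intros)
  then show ?thesis
    using has_arc_deriv_unique [OF has_arc_deriv_helicity] by (simp add: gradients_eq)
qed

text \<open>Differentiation removes the constant \<open>c v\<close> and turns the rotation field into \<open>v \<times> T\<close>, which is
  minus the area gradient.\<close>

lemma vortex_motion_imp_torsion_critical: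
  assumes "\<And>t. vortex_flow \<gamma> t = c0 *\<^sub>R reparam_flow \<gamma> t + b *\<^sub>R (v \<times> (\<gamma> t - p0)) + c *\<^sub>R v"
  shows "grad_torsion \<gamma> t = c0 *\<^sub>R grad_length \<gamma> t + b *\<^sub>R grad_area v \<gamma> t"
proof -
  have eq: "(\<lambda>t. T t \<times> T' t) = (\<lambda>t. c0 *\<^sub>R T t + b *\<^sub>R (v \<times> (\<gamma> t - p0)) + c *\<^sub>R v)"
    using assms by (simp add: flows_eq fun_eq_iff)
  have "arcD (\<lambda>t. T t \<times> T' t) (\<lambda>t. c0 *\<^sub>R T' t + b *\<^sub>R (v \<times> (T t - 0)) + c *\<^sub>R 0)"
    unfolding eq by (intro curve_intros)
  then have "T t \<times> T'' t = c0 *\<^sub>R T' t + b *\<^sub>R (v \<times> (T t - 0)) + c *\<^sub>R 0"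
    by (rule has_arc_deriv_unique [OF has_arc_deriv_vortex])
  then show ?thesis
    by (simp add: gradients_eq cross_skew [of v])
qed

text \<open>The cross product with \<open>T\<close> removes the reparametrization, and \<open>T \<times> (T \<times> T') = - T'\<close>.\<close>

lemma vortex_motion_imp_length_critical:
  assumes "\<And>t. vortex_flow \<gamma> t = c0 *\<^sub>R reparam_flow \<gamma> t + b *\<^sub>R (v \<times> (\<gamma> t - p0)) + c *\<^sub>R v"
  shows "grad_length \<gamma> t = c *\<^sub>R grad_area v \<gamma> t + b *\<^sub>R grad_volume p0 v \<gamma> t"
proof -
  have "grad_length \<gamma> t = T t \<times> vortex_flow \<gamma> t"
    by (simp add: gradients_eq flows_eq T_cross_cross_T')
  then show ?thesis
    by (simp add: assms cross_add_right cross_mult_right flows_eq gradients_eq)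
qed

text \<open>Here \<open>T' = - T \<times> K\<close> for the velocity field \<open>K\<close> of a Euclidean motion along the curve, so
  \<open>T \<times> T'\<close> is the normal part of \<open>K\<close>. The tangential part \<open>T \<bullet> K\<close> is constant, because \<open>T'\<close>
  is orthogonal to \<open>K\<close> and \<open>K' = b v \<times> T\<close> is orthogonal to \<open>T\<close>: a Killing field has constant
  inner product with the tangent of a curve whose curvature vector is orthogonal to the field.\<close>

lemma length_critical_imp_vortex_motion:
  assumes "\<And>t. grad_length \<gamma> t = c *\<^sub>R grad_area v \<gamma> t + b *\<^sub>R grad_volume p0 v \<gamma> t"
  obtains c0 where
    "\<And>t. vortex_flow \<gamma> t = c0 *\<^sub>R reparam_flow \<gamma> t + b *\<^sub>R (v \<times> (\<gamma> t - p0)) + c *\<^sub>R v"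
proof -
  define K where "K t = b *\<^sub>R (v \<times> (\<gamma> t - p0)) + c *\<^sub>R v" for t
  have T': "T' t = - (T t \<times> K t)" for t
    using assms [of t]
    by (simp add: K_def gradients_eq cross_add_right cross_mult_right minus_equation_iff [of "T' t"]
        add.commute)
  have K': "arcD K (\<lambda>t. b *\<^sub>R (v \<times> T t))"
    unfolding K_def by (rule has_arc_deriv_cong, (rule curve_intros)+) simp
  have "T t \<bullet> (b *\<^sub>R (v \<times> T t)) + T' t \<bullet> K t = 0" for t
    by (simp add: T' dot_cross_self)
  then have "arcD (\<lambda>t. T t \<bullet> K t) (\<lambda>t. 0)"
    by (intro has_arc_deriv_cong [OF has_arc_deriv_inner [OF has_arc_deriv_curve(2) K']])
  then obtain m where m: "\<And>t. T t \<bullet> K t = m"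
    using has_arc_deriv_zero_const by blast
  have "vortex_flow \<gamma> t = (- m) *\<^sub>R T t + K t" for t
    by (simp add: flows_eq T' T_cross_cross_T m)
  then show ?thesis
    by (intro that [of "- m"]) (simp add: flows_eq K_def)
qed

end

section \<open>Monodromy and the axis\<close>

lemma rotation_matrix_norm:
  fixes A :: "real^'n^'n"
  assumes "rotation_matrix A"
  shows "norm (A *v x) = norm x"
proof -
  have "orthogonal_transformation ((*v) A)"
    using assms
    by (simp add: rotation_matrix_def orthogonal_transformation_matrix matrix_of_matrix_vector_mul)
  then show ?thesis
    by (simp add: orthogonal_transformation)
qed

text \<open>The field \<open>y \<mapsto> w \<times> y + u\<close> is parallel to \<open>w\<close> exactly along the line through
  \<open>p0 = (w \<times> u) / |w|\<^sup>2\<close> in direction \<open>w\<close>. Since \<open>A\<close> fixes \<open>w\<close>, equivariance at a single point \<open>x\<close>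
  says \<open>A u = u + w \<times> a\<close>, which is equivariance everywhere; so the motion maps this line to itself.
  The proof works for every rotation \<open>A\<close>, including the identity.\<close>

lemma equivariant_rotation_field_axis:
  assumes A: "rotation_matrix A" and fixed: "A *v w = w" and "w \<noteq> 0"
    and equivariant: "w \<times> motion A a x + u = A *v (w \<times> x + u)"
  shows "\<exists>p0 v b c. is_axis A a p0 v \<and> w = b *\<^sub>R v \<and>
    (\<forall>y. w \<times> y + u = b *\<^sub>R (v \<times> (y - p0)) + c *\<^sub>R v)"
proof -
  define v where "v = w /\<^sub>R norm w"
  define p0 where "p0 = (w \<times> u) /\<^sub>R (w \<bullet> w)"
  have ww: "w \<bullet> w \<noteq> 0" "w = norm w *\<^sub>R v" "norm v = 1" "A *v v = v"
    using \<open>w \<noteq> 0\<close> fixed by (auto simp: v_def matrix_vector_mult_scaleR)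
  have "A *v (w \<times> x) = w \<times> (A *v x)"
    using cross_rotation_matrix [OF A, of w x] fixed by simp
  then have Au: "A *v u = u + w \<times> a"
    using equivariant by (simp add: motion_def cross_add_right matrix_vector_right_distrib add.commute)
  have "A *v (w \<times> u) = w \<times> (A *v u)"
    using cross_rotation_matrix [OF A, of w u] fixed by simp
  also have "\<dots> = w \<times> u + (w \<bullet> a) *\<^sub>R w - (w \<bullet> w) *\<^sub>R a"
    by (simp add: Au cross_add_right Lagrange)
  finally have "A *v p0 = p0 + ((w \<bullet> a) / (w \<bullet> w)) *\<^sub>R w - a"
    using ww(1) by (simp add: p0_def matrix_vector_mult_scaleR scaleR_add_right scaleR_diff_right
        divide_inverse mult.commute)
  then have "motion A a p0 = p0 + ((w \<bullet> a) / (w \<bullet> w)) *\<^sub>R (norm w *\<^sub>R v)"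
    by (simp add: motion_def ww(2) [symmetric])
  then obtain s where s: "motion A a p0 = p0 + s *\<^sub>R v"
    unfolding scaleR_scaleR by blast
  have line: "motion A a (p0 + r *\<^sub>R v) = p0 + (r + s) *\<^sub>R v" for r
    using s ww(4)
    by (simp add: motion_def matrix_vector_right_distrib matrix_vector_mult_scaleR algebra_simps)
  \<comment> \<open>The motion acts on the line as the shift \<open>r \<mapsto> r + s\<close> of its parameter.\<close>
  have "motion A a ` range (\<lambda>r. p0 + r *\<^sub>R v) = range ((\<lambda>r. p0 + r *\<^sub>R v) \<circ> (\<lambda>r. r + s))"
    by (simp add: image_image line o_def)
  also have "\<dots> = range (\<lambda>r. p0 + r *\<^sub>R v)"
    by (simp only: image_comp [symmetric] surj_plus_right)
  finally have "is_axis A a p0 v"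
    by (simp add: is_axis_def ww)
  moreover have "w \<times> y + u = norm w *\<^sub>R (v \<times> (y - p0)) + ((w \<bullet> u) / norm w) *\<^sub>R v" for y
  proof -
    have "norm w *\<^sub>R (v \<times> (y - p0)) = w \<times> y - w \<times> p0"
      by (metis ww(2) cross_mult_left Cross3.right_diff_distrib)
    also have "w \<times> p0 = ((w \<bullet> u) / norm w) *\<^sub>R v - u"
      using ww(1) by (simp add: p0_def cross_mult_right Lagrange scaleR_diff_right v_def
          dot_square_norm power2_eq_square field_simps)
    finally show ?thesis
      by simp
  qed
  ultimately show ?thesis
    using ww(2) by blast
qed

locale monodromy_curve = regular_curve +
  fixes \<tau> :: "real \<Rightarrow> real" and A :: "real^3^3" and a :: "real^3"
  assumes translation: "translation \<tau>" and rotation: "rotation_matrix A"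
    and monodromy: "\<And>t. \<gamma> (\<tau> t) = motion A a (\<gamma> t)"
begin

text \<open>The chain rule gives \<open>\<tau>' \<cdot> f'(\<tau> t) = A f'(t)\<close> for \<open>f\<close> and likewise for \<open>\<gamma>\<close>. Taking norms in
  the latter, where \<open>\<tau>' \<ge> 0\<close> is essential, shows that \<open>\<tau>'\<close> is the ratio of the two speeds, which is
  the factor that passing to arclength derivatives cancels.\<close>

lemma arc_deriv_equivariant:
  assumes "\<And>t. f differentiable (at t)" and f: "\<And>t. f (\<tau> t) = motion A b (f t)"
  shows "arc_deriv \<gamma> f (\<tau> t) = A *v arc_deriv \<gamma> f t"
proof -
  have chain: "vderiv \<tau> t *\<^sub>R vderiv g (\<tau> t) = A *v vderiv g t"
    if diff: "\<And>t. g differentiable (at t)" and g: "\<And>t. g (\<tau> t) = motion A d (g t)" for g d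
  proof (rule vector_derivative_unique_at)
    show "((g \<circ> \<tau>) has_vector_derivative vderiv \<tau> t *\<^sub>R vderiv g (\<tau> t)) (at t)"
      by (intro vector_diff_chain_at has_vector_derivative_vderiv diff
          translation_deriv_nonneg [OF translation])
    have "((\<lambda>t. A *v g t + d) has_vector_derivative A *v vderiv g t + 0) (at t)"
      by (intro has_vector_derivative_add has_vector_derivative_const
          bounded_linear.has_vector_derivative [OF matrix_vector_mul_bounded_linear]
          has_vector_derivative_vderiv diff)
    then show "((g \<circ> \<tau>) has_vector_derivative A *v vderiv g t) (at t)"
      by (simp add: o_def g motion_def)
  qed
  have "vderiv \<tau> t * norm (vderiv \<gamma> (\<tau> t)) = norm (vderiv \<gamma> t)"
  proof -
    have "norm (vderiv \<tau> t *\<^sub>R vderiv \<gamma> (\<tau> t)) = norm (vderiv \<gamma> t)"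
      by (simp only: chain [OF smooth_differentiable [OF smooth] monodromy]
          rotation_matrix_norm [OF rotation])
    then show ?thesis
      by (simp add: translation_deriv_nonneg(2) [OF translation])
  qed
  moreover from this
  have "vderiv \<tau> t \<noteq> 0"
    using immersed [of t] by auto
  then have "vderiv f (\<tau> t) /\<^sub>R norm (vderiv \<gamma> (\<tau> t)) =
      (vderiv \<tau> t *\<^sub>R vderiv f (\<tau> t)) /\<^sub>R (vderiv \<tau> t * norm (vderiv \<gamma> (\<tau> t)))"
    by simp
  ultimately show ?thesis
    using chain [OF assms]
    by (simp add: arc_deriv_def matrix_vector_mult_scaleR divide_inverse)
qed

lemma arc_equivariant: "arc \<gamma> (Suc k) (\<tau> t) = A *v arc \<gamma> (Suc k) t"
proof (induction k arbitrary: t)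
  case 0
  then show ?case
    using arc_deriv_equivariant [OF smooth_differentiable [OF smooth] monodromy]
    by (simp add: arc_def)
next
  case (Suc k)
  have "arc_deriv \<gamma> (arc \<gamma> (Suc k)) (\<tau> t) = A *v arc_deriv \<gamma> (arc \<gamma> (Suc k)) t"
    by (rule arc_deriv_equivariant [where b = 0])
       (simp_all add: Suc motion_def smooth_differentiable smooth_arc smooth immersed)
  then show ?case
    by (simp only: arc_Suc)
qed

lemma frame_equivariant:
  "T (\<tau> t) = A *v T t" "T' (\<tau> t) = A *v T' t" "T'' (\<tau> t) = A *v T'' t"
  using arc_equivariant [of 0] arc_equivariant [of 1] arc_equivariant [of 2]
  by (simp_all add: T_def T'_def T''_def eval_nat_numeral)

lemma helicity_equivariant: "helicity_flow \<gamma> (\<tau> t) = A *v helicity_flow \<gamma> t"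
proof -
  have "T' (\<tau> t) \<bullet> T' (\<tau> t) = T' t \<bullet> T' t"
    by (simp add: frame_equivariant rotation_matrix_norm [OF rotation] dot_square_norm)
  then show ?thesis
    by (simp add: flows_eq frame_equivariant matrix_vector_mult_diff_distrib
        matrix_vector_mult_scaleR linear_neg [OF matrix_vector_mul_linear])
qed

lemma axis_of_first_integral:
  assumes "A *v w = w" "w \<noteq> 0" and F: "\<And>t. F t = w \<times> \<gamma> t + u"
    and "\<And>t. F (\<tau> t) = A *v F t"
  shows "\<exists>p0 v b c. is_axis A a p0 v \<and> w = b *\<^sub>R v \<and>
    (\<forall>t. F t = b *\<^sub>R (v \<times> (\<gamma> t - p0)) + c *\<^sub>R v)"
proof -
  have "w \<times> motion A a (\<gamma> 0) + u = A *v (w \<times> \<gamma> 0 + u)"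
    using assms(4) [of 0] by (simp add: F monodromy)
  from equivariant_rotation_field_axis [OF rotation assms(1,2) this] show ?thesis
    unfolding F by blast
qed

text \<open>The only place where an axis has to be found. The first integral \<open>w\<close> is fixed by \<open>A\<close>. If
  \<open>w \<noteq> 0\<close>, the second integral is an equation of the form required by \<open>axis_of_first_integral\<close>.
  If \<open>w = 0\<close> it says \<open>T \<times> T' = c2 T + u\<close>. Then for \<open>u \<noteq> 0\<close> the tangent precesses about \<open>u\<close>, so the
  curve is a helix, a circle or a line with axis direction \<open>u\<close>, and \<open>T - u \<times> \<gamma>\<close> is a further
  integral. For \<open>u = 0\<close> the curve is a straight line, and it is itself an axis.\<close>

lemma elastic_imp_vortex_motion:
  assumes "\<And>t. grad_elastic \<gamma> t = c1 *\<^sub>R grad_length \<gamma> t + c2 *\<^sub>R grad_torsion \<gamma> t"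
  obtains p0 v c0 b c where "is_axis A a p0 v"
    "\<And>t. vortex_flow \<gamma> t = c0 *\<^sub>R reparam_flow \<gamma> t + b *\<^sub>R (v \<times> (\<gamma> t - p0)) + c *\<^sub>R v"
proof -
  obtain w where w: "\<And>t. - helicity_flow \<gamma> t + c1 *\<^sub>R T t + c2 *\<^sub>R (T t \<times> T' t) = w"
    using elastic_first_integral [OF assms] by blast
  then obtain u where u: "\<And>t. T t \<times> T' t - c2 *\<^sub>R T t = u - w \<times> \<gamma> t"
    using elastic_second_integral by blast
  have Aw: "A *v w = w"
  proof -
    have "A *v w = A *v (c1 *\<^sub>R T 0 + c2 *\<^sub>R (T 0 \<times> T' 0) - helicity_flow \<gamma> 0)"
      using w [of 0] by (simp add: algebra_simps)
    also have "\<dots> = c1 *\<^sub>R T (\<tau> 0) + c2 *\<^sub>R (T (\<tau> 0) \<times> T' (\<tau> 0)) - helicity_flow \<gamma> (\<tau> 0)"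
      by (simp add: frame_equivariant cross_rotation_matrix [OF rotation] helicity_equivariant
          matrix_vector_right_distrib matrix_vector_mult_diff_distrib matrix_vector_mult_scaleR)
    also have "\<dots> = w"
      using w [of "\<tau> 0"] by (simp add: algebra_simps)
    finally show ?thesis .
  qed
  have F_equivariant: "T (\<tau> t) \<times> T' (\<tau> t) - c2 *\<^sub>R T (\<tau> t) = A *v (T t \<times> T' t - c2 *\<^sub>R T t)" for t
    by (simp add: frame_equivariant cross_rotation_matrix [OF rotation] matrix_vector_mult_diff_distrib
        matrix_vector_mult_scaleR)
  consider "w \<noteq> 0" | "w = 0" "u \<noteq> 0" | "w = 0" "u = 0"
    by blast
  then show ?thesis
  proof cases
    case 1
    have "A *v (- w) = - w"
      using Aw by (simp add: linear_neg [OF matrix_vector_mul_linear])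
    moreover have "- w \<noteq> 0"
      using 1 by simp
    moreover have "T t \<times> T' t - c2 *\<^sub>R T t = (- w) \<times> \<gamma> t + u" for t
      by (simp add: u)
    ultimately obtain p0 v b c where axis: "is_axis A a p0 v"
      and F: "\<And>t. T t \<times> T' t - c2 *\<^sub>R T t = b *\<^sub>R (v \<times> (\<gamma> t - p0)) + c *\<^sub>R v"
      using axis_of_first_integral
        [where F = "\<lambda>t. T t \<times> T' t - c2 *\<^sub>R T t", OF _ _ _ F_equivariant] by blast
    show ?thesis
      using F by (intro that [OF axis, of c2 b c]) (simp add: flows_eq algebra_simps)
  next
    case 2
    have vortex: "T t \<times> T' t = c2 *\<^sub>R T t + u" for t
      using u [of t] 2 by (simp add: algebra_simps)
    have "A *v u = u"
      using F_equivariant [of 0] by (simp add: vortex)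
    have T': "T' t = u \<times> T t" for t
      using T_cross_cross_T' [of t]
      by (simp add: vortex cross_add_right cross_mult_right cross_skew [of u])
    have "arcD (\<lambda>t. T t - u \<times> \<gamma> t) (\<lambda>t. 0)"
      by (rule has_arc_deriv_cong, (rule curve_intros)+) (simp add: T')
    then obtain k where k: "\<And>t. T t - u \<times> \<gamma> t = k"
      using has_arc_deriv_zero_const by blast
    have "T t = u \<times> \<gamma> t + k" for t
      using k [of t] by (simp add: algebra_simps)
    then obtain p0 v b where axis: "is_axis A a p0 v" and "u = b *\<^sub>R v"
      using axis_of_first_integral
        [where F = T, OF \<open>A *v u = u\<close> \<open>u \<noteq> 0\<close> _ frame_equivariant(1)] by blast
    then show ?thesis
      by (intro that [OF axis, of c2 0 b]) (simp add: flows_eq vortex)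
  next
    case 3
    have vortex: "T t \<times> T' t = c2 *\<^sub>R T t" for t
      using u [of t] 3 by simp
    have T': "T' t = 0" for t
      using T_cross_cross_T' [of t] by (simp add: vortex cross_mult_right)
    have "arcD T (\<lambda>t. 0)"
      using has_arc_deriv_cong [OF has_arc_deriv_curve(2) T'] .
    then obtain e where e: "\<And>t. T t = e"
      using has_arc_deriv_zero_const by blast
    have "arcD (\<lambda>t. e \<times> \<gamma> t) (\<lambda>t. 0)"
      by (rule has_arc_deriv_cong, (rule curve_intros)+) (simp add: e)
    then obtain k where k: "\<And>t. e \<times> \<gamma> t = k"
      using has_arc_deriv_zero_const by blast
    have "A *v e = e" "e \<noteq> 0"
      using frame_equivariant(1) [of 0] T_T [of 0] by (auto simp: e)
    \<comment> \<open>The zero field is equivariant, and \<open>e \<times> \<gamma> - k = 0\<close> describes the line traced by \<open>\<gamma>\<close>.\<close>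
    moreover have "0 = e \<times> \<gamma> t + (- k)" for t
      by (simp add: k)
    ultimately obtain p0 v where axis: "is_axis A a p0 v"
      using axis_of_first_integral [of e "\<lambda>t. 0" "- k"] by auto
    show ?thesis
      by (intro that [OF axis, of 0 0 0]) (simp add: flows_eq T')
  qed
qed

end

theorem corollary2:
  fixes \<tau> :: "real \<Rightarrow> real" and A :: "real^3^3" and a :: "real^3" and \<gamma> :: "real \<Rightarrow> real^3"
  assumes "translation \<tau>"
    and "rotation_matrix A"
    and "\<gamma> \<in> monodromy_curves \<tau> A a"
  shows
    "(critical (grad_elastic \<gamma>) [grad_length \<gamma>, grad_torsion \<gamma>] \<longleftrightarrow>
       (\<exists>p0 v. is_axis A a p0 v \<and>
          critical (grad_torsion \<gamma>) [grad_length \<gamma>, grad_area v \<gamma>])) \<and>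
     (critical (grad_elastic \<gamma>) [grad_length \<gamma>, grad_torsion \<gamma>] \<longleftrightarrow>
       (\<exists>p0 v. is_axis A a p0 v \<and>
          critical (grad_length \<gamma>) [grad_area v \<gamma>, grad_volume p0 v \<gamma>])) \<and>
     (critical (grad_elastic \<gamma>) [grad_length \<gamma>, grad_torsion \<gamma>] \<longleftrightarrow>
       (\<exists>p0 v c1 c0 c. is_axis A a p0 v \<and>
          (\<forall>t. helicity_flow \<gamma> t =
                 c1 *\<^sub>R vortex_flow \<gamma> t + c0 *\<^sub>R reparam_flow \<gamma> t + c *\<^sub>R v))) \<and>
     (critical (grad_elastic \<gamma>) [grad_length \<gamma>, grad_torsion \<gamma>] \<longleftrightarrow>
       (\<exists>p0 v c0 b c. is_axis A a p0 v \<and>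
          (\<forall>t. vortex_flow \<gamma> t =
                 c0 *\<^sub>R reparam_flow \<gamma> t + b *\<^sub>R cross3 v (\<gamma> t - p0) + c *\<^sub>R v)))"
proof -
  interpret monodromy_curve \<gamma> \<tau> A a
    using assms
    by unfold_locales (auto simp: monodromy_curves_def fun_eq_iff)
  define elastic_crit where
    "elastic_crit \<longleftrightarrow> critical (grad_elastic \<gamma>) [grad_length \<gamma>, grad_torsion \<gamma>]"
  define torsion_crit where
    "torsion_crit v \<longleftrightarrow> critical (grad_torsion \<gamma>) [grad_length \<gamma>, grad_area v \<gamma>]" for v
  define length_crit where
    "length_crit p0 v \<longleftrightarrow> critical (grad_length \<gamma>) [grad_area v \<gamma>, grad_volume p0 v \<gamma>]" for p0 v
  define helicity_translates where "helicity_translates v \<longleftrightarrow> (\<exists>c1 c0 c. \<forall>t. helicity_flow \<gamma> t =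
    c1 *\<^sub>R vortex_flow \<gamma> t + c0 *\<^sub>R reparam_flow \<gamma> t + c *\<^sub>R v)" for v
  define vortex_moves where "vortex_moves p0 v \<longleftrightarrow> (\<exists>c0 b c. \<forall>t. vortex_flow \<gamma> t =
    c0 *\<^sub>R reparam_flow \<gamma> t + b *\<^sub>R (v \<times> (\<gamma> t - p0)) + c *\<^sub>R v)" for p0 v
  have "\<exists>p0 v. is_axis A a p0 v \<and> vortex_moves p0 v" if elastic_crit
    using that elastic_imp_vortex_motion
    unfolding elastic_crit_def vortex_moves_def critical_pair by metis
  moreover have "torsion_crit v" if "vortex_moves p0 v" for p0 v
    using that vortex_motion_imp_torsion_critical
    unfolding torsion_crit_def vortex_moves_def critical_pair by blast
  moreover have "length_crit p0 v" if "vortex_moves p0 v" for p0 v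
    using that vortex_motion_imp_length_critical
    unfolding length_crit_def vortex_moves_def critical_pair by blast
  moreover have "vortex_moves p0 v" if "length_crit p0 v" for p0 v
    using that length_critical_imp_vortex_motion
    unfolding length_crit_def vortex_moves_def critical_pair by metis
  moreover have "helicity_translates v" if "torsion_crit v" for v
    using that torsion_critical_imp_helicity
    unfolding torsion_crit_def helicity_translates_def critical_pair by metis
  moreover have elastic_crit if "helicity_translates v" for v
    using that helicity_imp_elastic_critical
    unfolding elastic_crit_def helicity_translates_def critical_pair by blast
  ultimately have
    "(elastic_crit \<longleftrightarrow> (\<exists>p0 v. is_axis A a p0 v \<and> torsion_crit v)) \<and>
     (elastic_crit \<longleftrightarrow> (\<exists>p0 v. is_axis A a p0 v \<and> length_crit p0 v)) \<and>
     (elastic_crit \<longleftrightarrow> (\<exists>p0 v. is_axis A a p0 v \<and> helicity_translates v)) \<and>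
     (elastic_crit \<longleftrightarrow> (\<exists>p0 v. is_axis A a p0 v \<and> vortex_moves p0 v))"
    by blast
  then show ?thesis
    unfolding elastic_crit_def torsion_crit_def length_crit_def helicity_translates_def
      vortex_moves_def ex_simps .
qed

end
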